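(* Let $N\ge 1$ be an integer, let $-\infty\le a<b\le\infty$, and let $\|\cdot\|_M$ be a matrix norm on $\mathbb{C}^{N\times N}$. For $\mathbf{f}\in L^2(a,b;\mathbb{C}^{N\times N})$ put $$\|\mathbf{f}\|_M=\left\|\int_a^b \mathbf{f}(t)\mathbf{f}^{\dagger}(t)\,dt\right\|_M^{1/2}\qquad\text{and}\qquad \|\mathbf{f}\|=\left(\int_a^b\|\mathbf{f}(t)\|_M^2\,dt\right)^{1/2}.$$ Then the norms $\|\mathbf{f}\|_M$ and $\|\mathbf{f}\|$ on $L^2(a,b;\mathbb{C}^{N\times N})$ are equivalent, in the sense that there exist constants $C_1>0$ and $C_2>0$ such that $$C_1\|\mathbf{f}\|\le\|\mathbf{f}\|_M\le C_2\|\mathbf{f}\|\quad\text{for all }\mathbf{f}\in L^2(a,b;\mathbb{C}^{N\times N}).$$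
   Context: $L^2(a,b)$ is the space of complex-valued square-integrable functions on the interval $(a,b)$. $L^2(a,b;\mathbb{C}^{N\times N})$ is the set of matrix-valued signals $\mathbf{f}(t)=(f_{kl}(t))_{1\le k,l\le N}$ with every entry $f_{kl}\in L^2(a,b)$ (signals equal almost everywhere are identified). Integrals of matrix-valued functions are taken entrywise, and $^{\dagger}$ denotes complex conjugate transpose. $\|\mathbf{f}(t)\|_M$ denotes the matrix norm of the constant matrix $\mathbf{f}(t)$ for fixed $t$. *)

theory Defs
  imports "HOL-Analysis.Analysis"
begin

(* Square complex matrices are complex^'n^'n, with N = CARD('n) (automatically N >= 1). *)

definition conj_transpose :: "complex^'n^'n \<Rightarrow> complex^'n^'n" where
  "conj_transpose A = map_matrix cnj (transpose A)"

(* A norm on the complex vector space of matrices. Submultiplicativity, which some authors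
   include in the term "matrix norm", is not required. *)
definition is_matrix_norm :: "(complex^'n^'n \<Rightarrow> real) \<Rightarrow> bool" where
  "is_matrix_norm \<nu> \<longleftrightarrow>
     (\<forall>A. 0 \<le> \<nu> A) \<and>
     (\<forall>A. \<nu> A = 0 \<longleftrightarrow> A = 0) \<and>
     (\<forall>c A. \<nu> (map_matrix (\<lambda>z. c * z) A) = cmod c * \<nu> A) \<and>
     (\<forall>A B. \<nu> (A + B) \<le> \<nu> A + \<nu> B)"

(* L2 spaces are sets of representatives, not quotients by almost-everywhere equality. The
   functions are total on the reals, but only their values on the open interval matter. *)
definition L2 :: "ereal \<Rightarrow> ereal \<Rightarrow> (real \<Rightarrow> complex) set" where
  "L2 a b = {g. g \<in> borel_measurable (lebesgue_on (einterval a b)) \<and>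
                integrable (lebesgue_on (einterval a b)) (\<lambda>t. (cmod (g t))\<^sup>2)}"

definition L2_matrix :: "ereal \<Rightarrow> ereal \<Rightarrow> (real \<Rightarrow> complex^'n^'n) set" where
  "L2_matrix a b = {f. \<forall>k l. (\<lambda>t. f t $ k $ l) \<in> L2 a b}"

definition matrix_integral ::
    "ereal \<Rightarrow> ereal \<Rightarrow> (real \<Rightarrow> complex^'n^'n) \<Rightarrow> complex^'n^'n" where
  "matrix_integral a b F = (\<chi> k l. LINT t|lebesgue_on (einterval a b). F t $ k $ l)"

definition correlation_norm ::
    "(complex^'n^'n \<Rightarrow> real) \<Rightarrow> ereal \<Rightarrow> ereal \<Rightarrow> (real \<Rightarrow> complex^'n^'n) \<Rightarrow> real" where
  "correlation_norm \<nu> a b f =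
     sqrt (\<nu> (matrix_integral a b (\<lambda>t. f t ** conj_transpose (f t))))"

definition pointwise_norm ::
    "(complex^'n^'n \<Rightarrow> real) \<Rightarrow> ereal \<Rightarrow> ereal \<Rightarrow> (real \<Rightarrow> complex^'n^'n) \<Rightarrow> real" where
  "pointwise_norm \<nu> a b f = sqrt (LINT t|lebesgue_on (einterval a b). (\<nu> (f t))\<^sup>2)"

end

(* Any norm on matrices is equivalent to the Euclidean (Frobenius) norm, so the square of the
   pointwise norm is comparable to S = integral of the squared Frobenius norm of f. For the
   Gram matrix G = integral of f f^dagger, the trace of G equals S, which bounds the norm of G
   from below, and every entry of G is at most a constant times S, which bounds it from above. *)
theory Submission
  imports Defs
begin

text \<open>Expanding a vector in \<open>Basis\<close> gives the upper bound, which makes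
  \<open>\<nu>\<close> Lipschitz; a continuous \<open>\<nu>\<close> attains a minimum on the compact
  unit sphere, and that minimum is the lower constant. Continuity is exported as well, because
  measurability of \<open>\<nu> (f t)\<close> rests on it.\<close>

lemma euclidean_norm_equivalence:
  fixes \<nu> :: "'a::euclidean_space \<Rightarrow> real"
  assumes nonneg: "\<And>x. 0 \<le> \<nu> x"
    and definite: "\<And>x. \<nu> x = 0 \<longleftrightarrow> x = 0"
    and scale: "\<And>r x. \<nu> (r *\<^sub>R x) = \<bar>r\<bar> * \<nu> x"
    and triangle: "\<And>x y. \<nu> (x + y) \<le> \<nu> x + \<nu> y"
  obtains m M where "0 < m" "0 < M" "\<And>x. m * norm x \<le> \<nu> x" "\<And>x. \<nu> x \<le> M * norm x"
    "continuous_on UNIV \<nu>"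
proof -
  \<comment> \<open>The summand 1 makes \<open>M\<close> positive from nonnegativity of
    \<open>\<nu>\<close> alone.\<close>
  define M where "M = (\<Sum>b\<in>Basis. \<nu> (b::'a)) + 1"
  have M: "0 < M"
    unfolding M_def using nonneg by (simp add: sum_nonneg add_nonneg_pos)
  have sub: "\<nu> (sum h A) \<le> (\<Sum>b\<in>A. \<nu> (h b))" if "finite A" for h :: "'a \<Rightarrow> 'a" and A
    using that
  proof (induction A rule: finite_induct)
    case empty
    then show ?case using definite[of 0] by simp
  next
    case (insert b A)
    then show ?case using triangle[of "h b" "sum h A"] by simp
  qed
  have upper: "\<nu> x \<le> M * norm x" for x
  proof -
    have "\<nu> x = \<nu> (\<Sum>b\<in>Basis. (x \<bullet> b) *\<^sub>R b)" by (simp add: euclidean_representation)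
    also have "\<dots> \<le> (\<Sum>b\<in>Basis. \<nu> ((x \<bullet> b) *\<^sub>R b))" by (rule sub) simp
    also have "\<dots> \<le> (\<Sum>b\<in>Basis. norm x * \<nu> b)"
      by (intro sum_mono) (simp add: scale Basis_le_norm mult_right_mono nonneg)
    also have "\<dots> \<le> M * norm x"
      unfolding M_def by (simp add: sum_distrib_left[symmetric] algebra_simps)
    finally show ?thesis .
  qed
  have lipschitz: "\<bar>\<nu> x - \<nu> y\<bar> \<le> M * norm (x - y)" for x y
  proof -
    \<comment> \<open>Evenness of \<open>\<nu>\<close> turns the two triangle inequalities into a
      bound on the absolute value.\<close>
    have "\<nu> (y - x) = \<nu> (x - y)" using scale[of "-1" "x - y"] by simp
    then show ?thesis
      using triangle[of "x - y" y] triangle[of "y - x" x] upper[of "x - y"] by simp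
  qed
  have "M-lipschitz_on UNIV \<nu>"
    by (rule lipschitz_onI) (use lipschitz M in \<open>auto simp: dist_norm\<close>)
  then have cont: "continuous_on UNIV \<nu>" by (rule lipschitz_on_continuous_on)
  have "sphere (0::'a) 1 \<noteq> {}" by simp
  then obtain u where u: "u \<in> sphere 0 1" "\<And>y. y \<in> sphere 0 1 \<Longrightarrow> \<nu> u \<le> \<nu> y"
    using continuous_attains_inf[OF compact_sphere _ continuous_on_subset[OF cont]] by blast
  have "u \<noteq> 0" using u(1) by auto
  then have m: "0 < \<nu> u" using nonneg[of u] definite[of u] by linarith
  have lower: "\<nu> u * norm x \<le> \<nu> x" for x
  proof (cases "x = 0")
    case False
    have "\<nu> u \<le> \<nu> (x /\<^sub>R norm x)" using False by (intro u(2)) simp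
    also have "\<dots> = \<nu> x / norm x" using False by (simp add: scale divide_inverse)
    finally show ?thesis using False by (simp add: field_simps)
  qed (simp add: nonneg)
  show ?thesis using that[OF m M lower upper cont] .
qed

text \<open>Complex homogeneity restricted to real scalars: this lets the matrices be treated as a
  real Euclidean space.\<close>

lemma is_matrix_norm_scaleR:
  assumes "is_matrix_norm \<nu>"
  shows "\<nu> (r *\<^sub>R A) = \<bar>r\<bar> * \<nu> A"
proof -
  have "r *\<^sub>R A = map_matrix (\<lambda>z. complex_of_real r * z) A"
    by (simp add: vec_eq_iff map_matrix_def scaleR_conv_of_real[where 'a = complex])
  then show ?thesis using assms unfolding is_matrix_norm_def by simp
qed

text \<open>Identifies the library norm on nested vectors with the Frobenius norm.\<close>

lemma matrix_norm_squared:
  fixes A :: "complex^'n^'m"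
  shows "(norm A)\<^sup>2 = (\<Sum>k\<in>UNIV. \<Sum>l\<in>UNIV. (cmod (A $ k $ l))\<^sup>2)"
  by (simp add: norm_vec_def L2_set_def sum_nonneg)

lemma cmod_entry_le_norm: "cmod ((A :: complex^'n^'m) $ k $ l) \<le> norm A"
  using Finite_Cartesian_Product.norm_nth_le[of A k] Finite_Cartesian_Product.norm_nth_le[of "A $ k" l] by linarith

lemma matrix_norm_le_sum:
  fixes A :: "complex^'n^'m"
  shows "norm A \<le> (\<Sum>k\<in>UNIV. \<Sum>l\<in>UNIV. cmod (A $ k $ l))"
proof -
  have "norm A \<le> (\<Sum>k\<in>UNIV. norm (A $ k))"
    unfolding norm_vec_def[of A] by (rule L2_set_le_sum) simp
  also have "\<dots> \<le> (\<Sum>k\<in>UNIV. \<Sum>l\<in>UNIV. cmod (A $ k $ l))"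
    unfolding norm_vec_def by (intro sum_mono L2_set_le_sum) simp
  finally show ?thesis .
qed

lemma gram_entry:
  "(A ** conj_transpose A) $ k $ l = (\<Sum>j\<in>UNIV. A $ k $ j * cnj (A $ l $ j))"
  by (simp add: matrix_matrix_mult_def conj_transpose_def map_matrix_def transpose_def)

text \<open>Each of the N products in the entry is at most the squared norm. This crude bound serves
  both as an integrable majorant and as the estimate for the entries of the integral.\<close>

lemma cmod_gram_entry_le:
  fixes A :: "complex^'n^'n"
  shows "cmod ((A ** conj_transpose A) $ k $ l) \<le> real CARD('n) * (norm A)\<^sup>2"
proof -
  have "cmod ((A ** conj_transpose A) $ k $ l) \<le> (\<Sum>j\<in>(UNIV::'n set). (norm A)\<^sup>2)"
    unfolding gram_entry power2_eq_square
    by (rule sum_norm_le) (auto simp: norm_mult intro!: mult_mono cmod_entry_le_norm)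
  then show ?thesis by simp
qed

lemma trace_gram:
  fixes A :: "complex^'n^'n"
  shows "(\<Sum>k\<in>UNIV. (A ** conj_transpose A) $ k $ k) = complex_of_real ((norm A)\<^sup>2)"
  by (simp add: gram_entry matrix_norm_squared complex_mult_cnj cmod_power2)

lemma L2_matrix_measurable:
  fixes f :: "real \<Rightarrow> complex^'n^'n"
  assumes "f \<in> L2_matrix a b"
  shows "(\<lambda>t. f t $ k $ l) \<in> borel_measurable (lebesgue_on (einterval a b))"
    and "f \<in> borel_measurable (lebesgue_on (einterval a b))"
proof -
  show entry: "(\<lambda>t. f t $ k $ l) \<in> borel_measurable (lebesgue_on (einterval a b))" for k l
    using assms by (simp add: L2_matrix_def L2_def)
  show "f \<in> borel_measurable (lebesgue_on (einterval a b))"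
  \<comment> \<open>Measurability is tested by pairing with basis vectors \<open>B\<close>; the real
    inner product of matrices is a finite sum of inner products of the entries.\<close>
  proof (subst borel_measurable_euclidean_space, intro ballI)
    fix B :: "complex^'n^'n"
    have "(\<lambda>t. \<Sum>k\<in>UNIV. \<Sum>l\<in>UNIV. (f t $ k $ l) \<bullet> (B $ k $ l))
        \<in> borel_measurable (lebesgue_on (einterval a b))"
      using entry by measurable
    then show "(\<lambda>t. f t \<bullet> B) \<in> borel_measurable (lebesgue_on (einterval a b))"
      by (simp add: inner_vec_def)
  qed
qed

lemma L2_matrix_integrable_norm:
  assumes "f \<in> L2_matrix a b"
  shows "integrable (lebesgue_on (einterval a b)) (\<lambda>t. (norm (f t))\<^sup>2)"
  using assms unfolding matrix_norm_squared L2_matrix_def L2_def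
  by (intro Bochner_Integration.integrable_sum) simp

lemma L2_matrix_integrable_gram:
  fixes f :: "real \<Rightarrow> complex^'n^'n"
  assumes "f \<in> L2_matrix a b"
  shows "integrable (lebesgue_on (einterval a b)) (\<lambda>t. (f t ** conj_transpose (f t)) $ k $ l)"
proof (rule Bochner_Integration.integrable_bound)
  show "integrable (lebesgue_on (einterval a b)) (\<lambda>t. real CARD('n) * (norm (f t))\<^sup>2)"
    using L2_matrix_integrable_norm[OF assms] by simp
  have cnj: "cnj \<in> borel_measurable borel"
    by (intro borel_measurable_continuous_onI continuous_intros)
  have "(\<lambda>t. cnj (f t $ k $ l)) \<in> borel_measurable (lebesgue_on (einterval a b))" for k l
    by (rule measurable_compose[OF L2_matrix_measurable(1)[OF assms] cnj])
  then show "(\<lambda>t. (f t ** conj_transpose (f t)) $ k $ l)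
      \<in> borel_measurable (lebesgue_on (einterval a b))"
    unfolding gram_entry using L2_matrix_measurable(1)[OF assms] by simp
  show "AE t in lebesgue_on (einterval a b). norm ((f t ** conj_transpose (f t)) $ k $ l)
      \<le> norm (real CARD('n) * (norm (f t))\<^sup>2)"
    by (intro AE_I2) (simp add: cmod_gram_entry_le)
qed

text \<open>The first bound integrates the trace identity and estimates N diagonal entries by
  \<open>norm G\<close>. In the second, N^2 entries of size at most \<open>N * S\<close> produce the
  factor N^3.\<close>

lemma gram_integral_norm_bounds:
  fixes f :: "real \<Rightarrow> complex^'n^'n"
  assumes f: "f \<in> L2_matrix a b"
  defines "G \<equiv> matrix_integral a b (\<lambda>t. f t ** conj_transpose (f t))"
    and "S \<equiv> LINT t|lebesgue_on (einterval a b). (norm (f t))\<^sup>2"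
  shows "S \<le> real CARD('n) * norm G" and "norm G \<le> real CARD('n) ^ 3 * S"
proof -
  let ?L = "lebesgue_on (einterval a b)"
  note int = L2_matrix_integrable_gram[OF f]
  \<comment> \<open>The trace is a complex number, so the real \<open>S\<close> is embedded first;
    taking moduli then returns to the reals.\<close>
  have "complex_of_real S = (\<Sum>k\<in>UNIV. G $ k $ k)"
    unfolding S_def G_def matrix_integral_def
    by (simp add: integral_complex_of_real[symmetric] trace_gram[symmetric]
        Bochner_Integration.integral_sum int del: of_real_power)
  then have "\<bar>S\<bar> = cmod (\<Sum>k\<in>UNIV. G $ k $ k)"
    by (metis norm_of_real)
  also have "\<dots> \<le> (\<Sum>k\<in>(UNIV::'n set). norm G)"
    by (intro sum_norm_le cmod_entry_le_norm)
  finally show "S \<le> real CARD('n) * norm G" by simp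
  have entry: "cmod (G $ k $ l) \<le> real CARD('n) * S" for k l
  proof -
    have "cmod (G $ k $ l) \<le> (LINT t|?L. real CARD('n) * (norm (f t))\<^sup>2)"
      unfolding G_def matrix_integral_def
      using Bochner_Integration.integral_norm_bound_integral[OF int
          integrable_mult_right[OF L2_matrix_integrable_norm[OF f]] cmod_gram_entry_le]
      by simp
    then show ?thesis by (simp add: S_def)
  qed
  have "norm G \<le> (\<Sum>k\<in>UNIV. \<Sum>l\<in>UNIV. cmod (G $ k $ l))" by (rule matrix_norm_le_sum)
  also have "\<dots> \<le> (\<Sum>k\<in>(UNIV::'n set). \<Sum>l\<in>(UNIV::'n set). real CARD('n) * S)"
    by (intro sum_mono entry)
  finally show "norm G \<le> real CARD('n) ^ 3 * S" by (simp add: power3_eq_cube mult.assoc)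
qed

theorem proposition1:
  fixes a b :: ereal and \<nu> :: "complex^'n^'n \<Rightarrow> real"
  assumes "a < b" and "is_matrix_norm \<nu>"
  shows "\<exists>C1 C2 :: real. C1 > 0 \<and> C2 > 0 \<and>
           (\<forall>f \<in> L2_matrix a b.
              C1 * pointwise_norm \<nu> a b f \<le> correlation_norm \<nu> a b f \<and>
              correlation_norm \<nu> a b f \<le> C2 * pointwise_norm \<nu> a b f)"
proof -
  have nonneg: "0 \<le> \<nu> A" for A using assms(2) by (simp add: is_matrix_norm_def)
  have definite: "\<nu> A = 0 \<longleftrightarrow> A = 0" for A using assms(2) by (simp add: is_matrix_norm_def)
  have triangle: "\<nu> (A + B) \<le> \<nu> A + \<nu> B" for A B
    using assms(2) by (simp add: is_matrix_norm_def)
  obtain m M where m: "0 < m" and M: "0 < M"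
    and lower: "\<And>A. m * norm A \<le> \<nu> A" and upper: "\<And>A. \<nu> A \<le> M * norm A"
    and cont: "continuous_on UNIV \<nu>"
    using euclidean_norm_equivalence[OF nonneg definite is_matrix_norm_scaleR[OF assms(2)] triangle]
    by blast
  define N where "N = real CARD('n)"
  have N: "0 < N" by (simp add: N_def)
  \<comment> \<open>The radicands come from two chains, with \<open>P\<close> and \<open>S\<close>
    the integrals of the squared \<open>\<nu>\<close> norm and Frobenius norm:
    \<open>m * P \<le> m * M^2 * S \<le> N * M^2 * \<nu> G\<close> and
    \<open>m^2 * \<nu> G \<le> m^2 * M * N^3 * S \<le> M * N^3 * P\<close>.\<close>
  define C1 where "C1 = sqrt (m / (N * M\<^sup>2))"
  define C2 where "C2 = sqrt (M * N ^ 3 / m\<^sup>2)"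
  have "C1 * pointwise_norm \<nu> a b f \<le> correlation_norm \<nu> a b f \<and>
      correlation_norm \<nu> a b f \<le> C2 * pointwise_norm \<nu> a b f" if f: "f \<in> L2_matrix a b" for f
  proof -
    let ?L = "lebesgue_on (einterval a b)"
    define G where "G = matrix_integral a b (\<lambda>t. f t ** conj_transpose (f t))"
    define S where "S = (LINT t|?L. (norm (f t))\<^sup>2)"
    define P where "P = (LINT t|?L. (\<nu> (f t))\<^sup>2)"
    have bounds: "m\<^sup>2 * (norm A)\<^sup>2 \<le> (\<nu> A)\<^sup>2" "(\<nu> A)\<^sup>2 \<le> M\<^sup>2 * (norm A)\<^sup>2" for A
      using power_mono[OF lower[of A], of 2] power_mono[OF upper[of A] nonneg, of 2] m
      by (simp_all add: power_mult_distrib)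
    note intS = L2_matrix_integrable_norm[OF f]
    \<comment> \<open>Measurability together with the majorant \<open>M^2 * (norm (f t))^2\<close>
      yields integrability, which \<open>integral_mono\<close> demands before \<open>P\<close> and
      \<open>S\<close> can be compared.\<close>
    have "(\<lambda>t. \<nu> (f t)) \<in> borel_measurable ?L"
      by (rule measurable_compose[OF L2_matrix_measurable(2)[OF f]
            borel_measurable_continuous_onI[OF cont]])
    then have intP: "integrable ?L (\<lambda>t. (\<nu> (f t))\<^sup>2)"
      by (intro Bochner_Integration.integrable_bound[OF integrable_mult_right[OF intS, of "M\<^sup>2"]])
        (auto simp: bounds)
    have PS: "P \<le> M\<^sup>2 * S"
      using integral_mono[OF intP integrable_mult_right[OF intS, of "M\<^sup>2"] bounds(2)]
      by (simp add: P_def S_def)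
    have SP: "m\<^sup>2 * S \<le> P"
      using integral_mono[OF integrable_mult_right[OF intS, of "m\<^sup>2"] intP bounds(1)]
      by (simp add: P_def S_def)
    have SG: "S \<le> N * norm G" and GS: "norm G \<le> N ^ 3 * S"
      using gram_integral_norm_bounds[OF f] by (simp_all add: N_def G_def S_def)
    have "m * P \<le> m * (M\<^sup>2 * S)" using PS m by simp
    also have "\<dots> \<le> m * (M\<^sup>2 * (N * norm G))" using SG m by (simp add: mult_left_mono)
    also have "\<dots> = N * M\<^sup>2 * (m * norm G)" by simp
    also have "\<dots> \<le> N * M\<^sup>2 * \<nu> G" using lower[of G] N by (intro mult_left_mono) auto
    finally have left: "m / (N * M\<^sup>2) * P \<le> \<nu> G" using N M by (simp add: field_simps)
    have "m\<^sup>2 * \<nu> G \<le> m\<^sup>2 * (M * (N ^ 3 * S))"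
      using order_trans[OF upper[of G] mult_left_mono[OF GS]] M by (intro mult_left_mono) auto
    also have "\<dots> = M * N ^ 3 * (m\<^sup>2 * S)" by simp
    also have "\<dots> \<le> M * N ^ 3 * P" using SP M N by (intro mult_left_mono) auto
    finally have right: "\<nu> G \<le> M * N ^ 3 / m\<^sup>2 * P" using m by (simp add: field_simps)
    \<comment> \<open>Both norms are square roots, so the inequalities between \<open>P\<close> and
      \<open>\<nu> G\<close> pass through the monotone, multiplicative \<open>sqrt\<close>.\<close>
    show ?thesis
      using left right unfolding pointwise_norm_def correlation_norm_def C1_def C2_def
      by (simp add: real_sqrt_mult[symmetric] flip: G_def P_def)
  qed
  moreover have "0 < C1" "0 < C2" using m M N by (simp_all add: C1_def C2_def)
  ultimately show ?thesis by blast
qed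

end
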